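(* For every $h\in[H]$, $s\in\mathcal S$, $a\in\mathcal A_h(s)$, $\mathbf b=(b_{s'})_{s'\in\mathcal S}\in(\mathbb R^m)^S$, $u\in\mathbb R^m$ and $t\in[S+1]$, $$f^{s,a}_{h,\mathbf b}(t,u)\ \le\ \hat f^{s,a}_{h,\mathbf b}(t,u)\ \le\ f^{s,a}_{h,\mathbf b}(t,u)+(S-t+1)\ell.$$
   Context: Setting. We have a finite state set $\mathcal S=\{1,\dots,S\}$, action sets $\mathcal A_h(s)$, and transition distributions $P_h(\cdot\mid s,a)$ for $h\in[H]$. Vector inequalities are componentwise, and scalars added to vectors are added to each coordinate. SR functions. Let $f:\mathbb R^m\times\mathbb R^m\to\mathbb R^m$ satisfy: - $f$ is associative; - $f$ is componentwise non-decreasing in each argument; - $f$ is $1$-Lipschitz in each argument for $\|\cdot\|_\infty$; - $f(0,x)=f(x,0)=x$. Let $g:[0,1]\to[0,1]$ satisfy $g(0)=0$. Write $f_{s'=t}^S y_{s'}=f(y_t,f(y_{t+1},\dots,y_S))$. Assume $x\mapsto f_{s'=1}^S g(p_{s'})x_{s'}$ is $1$-Lipschitz for $\|\cdot\|_\infty$ for every probability vector $p$. Exact aggregate. $f^{s,a}_{h,\mathbf b}(t,F)=f\big(F,f_{s'=t}^S g(P_h(s'\mid s,a))b_{s'}\big)$, equal to $F$ when $t=S+1$. Rounded aggregate. Fix $\ell>0$ and let $\lceil x\rceil_\ell=\lceil x/\ell\rceil\ell$ componentwise (smallest integer multiple of $\ell$ that is at least $x$). Define $\hat f^{s,a}_{h,\mathbf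 b}(S+1,F)=F$ and $\hat f^{s,a}_{h,\mathbf b}(t,F)=\hat f^{s,a}_{h,\mathbf b}\big(t+1,\lceil f(F,g(P_h(t\mid s,a))b_t)\rceil_\ell\big)$ for $t\in[S]$. *)

theory Defs
  imports "HOL-Analysis.Analysis"
begin

definition prob_vector :: "nat \<Rightarrow> (nat \<Rightarrow> real) \<Rightarrow> bool" where
  "prob_vector S p \<longleftrightarrow> (\<forall>s\<in>{1..S}. 0 \<le> p s) \<and> (\<Sum>s=1..S. p s) = 1"

text \<open>Right-nested iteration \<open>f (y t) (f (y (t+1)) (\<dots> (f (y (S-1)) (y S))))\<close>, for \<open>t \<le> S\<close>.\<close>

definition iter_agg :: "('v \<Rightarrow> 'v \<Rightarrow> 'v) \<Rightarrow> (nat \<Rightarrow> 'v) \<Rightarrow> nat \<Rightarrow> nat \<Rightarrow> 'v" where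
  "iter_agg f y t S = foldr (\<lambda>s'. f (y s')) [t..<S] (y S)"

text \<open>The sup norm on families \<open>(x s)\<close>, \<open>1 \<le> s \<le> S\<close>; intended for \<open>S \<ge> 1\<close>.\<close>

definition family_norm :: "nat \<Rightarrow> (nat \<Rightarrow> real ^ 'm) \<Rightarrow> real" where
  "family_norm S x = (MAX s\<in>{1..S}. infnorm (x s))"

text \<open>The order on \<open>real ^ 'm\<close> is the componentwise one and \<open>infnorm\<close> is the maximum norm.\<close>

definition SR_operator :: "(real ^ 'm \<Rightarrow> real ^ 'm \<Rightarrow> real ^ 'm) \<Rightarrow> bool" where
  "SR_operator f \<longleftrightarrow>
     (\<forall>x y z. f (f x y) z = f x (f y z)) \<and>
     (\<forall>x x' y. x \<le> x' \<longrightarrow> f x y \<le> f x' y) \<and>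
     (\<forall>x y y'. y \<le> y' \<longrightarrow> f x y \<le> f x y') \<and>
     (\<forall>x x' y. infnorm (f x y - f x' y) \<le> infnorm (x - x')) \<and>
     (\<forall>x y y'. infnorm (f x y - f x y') \<le> infnorm (y - y')) \<and>
     (\<forall>x. f 0 x = x \<and> f x 0 = x)"

definition SR_weight :: "(real \<Rightarrow> real) \<Rightarrow> bool" where
  "SR_weight g \<longleftrightarrow> g \<in> {0..1} \<rightarrow> {0..1} \<and> g 0 = 0"

definition SR_aggregate_lipschitz ::
  "nat \<Rightarrow> (real ^ 'm \<Rightarrow> real ^ 'm \<Rightarrow> real ^ 'm) \<Rightarrow> (real \<Rightarrow> real) \<Rightarrow> bool" where
  "SR_aggregate_lipschitz S f g \<longleftrightarrow>
     (\<forall>p. prob_vector S p \<longrightarrow>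
       (\<forall>x y. infnorm (iter_agg f (\<lambda>s'. g (p s') *\<^sub>R x s') 1 S
                     - iter_agg f (\<lambda>s'. g (p s') *\<^sub>R y s') 1 S)
              \<le> family_norm S (\<lambda>s'. x s' - y s')))"

text \<open>In the two aggregates below, \<open>p\<close> stands for the distribution \<open>P h s a\<close>, the only way in
  which they depend on \<open>h\<close>, \<open>s\<close> and \<open>a\<close>.\<close>

definition exact_agg ::
  "nat \<Rightarrow> (real ^ 'm \<Rightarrow> real ^ 'm \<Rightarrow> real ^ 'm) \<Rightarrow> (real \<Rightarrow> real) \<Rightarrow> (nat \<Rightarrow> real)
    \<Rightarrow> (nat \<Rightarrow> real ^ 'm) \<Rightarrow> nat \<Rightarrow> real ^ 'm \<Rightarrow> real ^ 'm" where
  "exact_agg S f g p b t F =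
     (if t = S + 1 then F else f F (iter_agg f (\<lambda>s'. g (p s') *\<^sub>R b s') t S))"

definition round_up :: "real \<Rightarrow> real ^ 'm \<Rightarrow> real ^ 'm" where
  "round_up l x = (\<chi> i. of_int \<lceil>x $ i / l\<rceil> * l)"

function rounded_agg ::
  "nat \<Rightarrow> real \<Rightarrow> (real ^ 'm \<Rightarrow> real ^ 'm \<Rightarrow> real ^ 'm) \<Rightarrow> (real \<Rightarrow> real) \<Rightarrow> (nat \<Rightarrow> real)
    \<Rightarrow> (nat \<Rightarrow> real ^ 'm) \<Rightarrow> nat \<Rightarrow> real ^ 'm \<Rightarrow> real ^ 'm" where
  "rounded_agg S l f g p b t F =
     (if t \<le> S then rounded_agg S l f g p b (t + 1) (round_up l (f F (g (p t) *\<^sub>R b t))) else F)"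
  by pat_completeness auto
termination
  by (relation "Wellfounded.measure (\<lambda>(S, l, f, g, p, b, t, F). S + 1 - t)") auto

declare rounded_agg.simps [simp del]

end

theory Submission
  imports Defs
begin

text \<open>By associativity, the exact aggregate satisfies the recursion of the rounded one with the
  rounding left out. Backward induction on \<open>t\<close> then gives both bounds: monotonicity in \<open>F\<close> shows
  that rounding up never decreases the value, and the Lipschitz property in \<open>F\<close> shows that each of
  the \<open>S - t + 1\<close> roundings costs at most \<open>l\<close>.\<close>

definition infnorm_nonexpansive :: "('a::euclidean_space \<Rightarrow> 'b::euclidean_space) \<Rightarrow> bool" where
  "infnorm_nonexpansive \<phi> \<longleftrightarrow> (\<forall>x y. infnorm (\<phi> x - \<phi> y) \<le> infnorm (x - y))"

lemma infnorm_le_iff_cart: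
  fixes x :: "real ^ 'm"
  shows "infnorm x \<le> c \<longleftrightarrow> (\<forall>i. \<bar>x $ i\<bar> \<le> c)"
proof
  assume "infnorm x \<le> c"
  then show "\<forall>i. \<bar>x $ i\<bar> \<le> c"
    using component_le_infnorm_cart order_trans by blast
next
  assume "\<forall>i. \<bar>x $ i\<bar> \<le> c"
  then show "infnorm x \<le> c"
    by (simp add: infnorm_Max Basis_vec_def inner_axis)
qed

lemma infnorm_diff_le_iff_le_add_vec:
  fixes x y :: "real ^ 'm"
  shows "infnorm (x - y) \<le> c \<longleftrightarrow> x \<le> y + vec c \<and> y \<le> x + vec c"
proof -
  have "\<bar>(x - y) $ i\<bar> \<le> c \<longleftrightarrow> x $ i \<le> (y + vec c) $ i \<and> y $ i \<le> (x + vec c) $ i" for i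
    by auto
  then show ?thesis
    unfolding infnorm_le_iff_cart less_eq_vec_def by blast
qed

lemma infnorm_nonexpansive_le_add_vec:
  fixes \<phi> :: "real ^ 'm \<Rightarrow> real ^ 'n"
  assumes "infnorm_nonexpansive \<phi>" "infnorm (x - y) \<le> c"
  shows "\<phi> x \<le> \<phi> y + vec c"
proof -
  have "infnorm (\<phi> x - \<phi> y) \<le> c"
    using assms unfolding infnorm_nonexpansive_def by (meson order_trans)
  then show ?thesis
    by (simp add: infnorm_diff_le_iff_le_add_vec)
qed

lemma SR_operator_semigroup: "SR_operator f \<Longrightarrow> semigroup f"
  by (simp add: SR_operator_def semigroup_def)

lemma SR_operator_mono_left: "SR_operator f \<Longrightarrow> mono (\<lambda>x. f x y)"
  by (simp add: SR_operator_def mono_def)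

lemma SR_operator_nonexpansive_left: "SR_operator f \<Longrightarrow> infnorm_nonexpansive (\<lambda>x. f x y)"
  by (simp add: SR_operator_def infnorm_nonexpansive_def)

lemma le_round_up:
  assumes "l > 0"
  shows "x \<le> round_up l x"
proof -
  have "x $ i \<le> of_int \<lceil>x $ i / l\<rceil> * l" for i
    using assms by (simp flip: pos_divide_le_eq)
  then show ?thesis
    by (simp add: less_eq_vec_def round_up_def)
qed

lemma round_up_le_add_vec:
  assumes "l > 0"
  shows "round_up l x \<le> x + vec l"
proof -
  have "of_int \<lceil>x $ i / l\<rceil> * l \<le> x $ i + l" for i
    using mult_right_mono[OF of_int_ceiling_le_add_one[of "x $ i / l"], of l] assms
    by (simp add: distrib_right)
  then show ?thesis
    by (simp add: less_eq_vec_def round_up_def)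
qed

lemma infnorm_round_up_diff_le:
  assumes "l > 0"
  shows "infnorm (round_up l x - x) \<le> l"
proof -
  have "x \<le> x + vec l"
    using assms by (simp add: less_eq_vec_def)
  also have "\<dots> \<le> round_up l x + vec l"
    using le_round_up[OF assms] by (rule add_right_mono)
  finally show ?thesis
    using round_up_le_add_vec[OF assms] by (simp add: infnorm_diff_le_iff_le_add_vec)
qed

lemma iter_agg_last: "iter_agg f y S S = y S"
  by (simp add: iter_agg_def)

lemma iter_agg_step: "t < S \<Longrightarrow> iter_agg f y t S = f (y t) (iter_agg f y (t + 1) S)"
  by (simp add: iter_agg_def upt_conv_Cons)

lemma exact_agg_end: "exact_agg S f g p b (S + 1) F = F"
  by (simp add: exact_agg_def)

lemma exact_agg_step:
  assumes "semigroup f" "t \<le> S"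
  shows "exact_agg S f g p b t F = exact_agg S f g p b (t + 1) (f F (g (p t) *\<^sub>R b t))"
proof (cases "t = S")
  case True
  then show ?thesis
    by (simp add: exact_agg_def iter_agg_last)
next
  case False
  with assms show ?thesis
    by (simp add: exact_agg_def iter_agg_step semigroup.assoc)
qed

lemma mono_exact_agg:
  assumes "\<And>y. mono (\<lambda>x. f x y)"
  shows "mono (exact_agg S f g p b t)"
  using assms by (simp add: exact_agg_def mono_def)

lemma infnorm_nonexpansive_exact_agg:
  assumes "\<And>y. infnorm_nonexpansive (\<lambda>x. f x y)"
  shows "infnorm_nonexpansive (exact_agg S f g p b t)"
  using assms by (simp add: exact_agg_def infnorm_nonexpansive_def)

lemma rounded_agg_end: "rounded_agg S l f g p b (S + 1) F = F"
  by (simp add: rounded_agg.simps)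

lemma rounded_agg_step:
  "t \<le> S \<Longrightarrow>
    rounded_agg S l f g p b t F =
      rounded_agg S l f g p b (t + 1) (round_up l (f F (g (p t) *\<^sub>R b t)))"
  by (simp add: rounded_agg.simps[of _ _ _ _ _ _ t])

lemma exact_agg_le_rounded_agg:
  assumes "semigroup f" and mono_left: "\<And>y. mono (\<lambda>x. f x y)" and "l > 0" and "t \<le> S + 1"
  shows "exact_agg S f g p b t F \<le> rounded_agg S l f g p b t F"
  using \<open>t \<le> S + 1\<close>
proof (induction t arbitrary: F rule: inc_induct)
  case base
  show ?case
    unfolding exact_agg_end rounded_agg_end by (rule order_refl)
next
  case (step t)
  then have "t \<le> S" by simp
  define G where "G = f F (g (p t) *\<^sub>R b t)"
  have "exact_agg S f g p b t F = exact_agg S f g p b (t + 1) G"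
    unfolding G_def by (rule exact_agg_step[OF \<open>semigroup f\<close> \<open>t \<le> S\<close>])
  also have "\<dots> \<le> exact_agg S f g p b (t + 1) (round_up l G)"
    using le_round_up[OF \<open>l > 0\<close>] by (rule monoD[OF mono_exact_agg[OF mono_left]])
  also have "\<dots> \<le> rounded_agg S l f g p b (t + 1) (round_up l G)"
    using step.IH by simp
  also have "\<dots> = rounded_agg S l f g p b t F"
    unfolding G_def by (rule rounded_agg_step[OF \<open>t \<le> S\<close>, symmetric])
  finally show ?case .
qed

lemma rounded_agg_le_exact_agg_add_vec:
  assumes "semigroup f" and nonexpansive_left: "\<And>y. infnorm_nonexpansive (\<lambda>x. f x y)"
    and "l > 0" and "t \<le> S + 1"
  shows "rounded_agg S l f g p b t F \<le> exact_agg S f g p b t F + vec ((real S - real t + 1) * l)"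
  using \<open>t \<le> S + 1\<close>
proof (induction t arbitrary: F rule: inc_induct)
  case base
  show ?case
    unfolding exact_agg_end rounded_agg_end by simp
next
  case (step t)
  then have "t \<le> S" by simp
  define G where "G = f F (g (p t) *\<^sub>R b t)"
  have "rounded_agg S l f g p b t F = rounded_agg S l f g p b (t + 1) (round_up l G)"
    unfolding G_def by (rule rounded_agg_step[OF \<open>t \<le> S\<close>])
  also have "\<dots> \<le> exact_agg S f g p b (t + 1) (round_up l G) + vec ((real S - real t) * l)"
    using step.IH[of "round_up l G"] by simp
  also have "\<dots> \<le> exact_agg S f g p b (t + 1) G + vec l + vec ((real S - real t) * l)"
    using infnorm_round_up_diff_le[OF \<open>l > 0\<close>]
    by (intro add_right_mono infnorm_nonexpansive_le_add_vec[OF infnorm_nonexpansive_exact_agg]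
        nonexpansive_left)
  also have "\<dots> = exact_agg S f g p b (t + 1) G + vec ((real S - real t + 1) * l)"
    by (simp add: vec_eq_iff algebra_simps)
  also have "\<dots> = exact_agg S f g p b t F + vec ((real S - real t + 1) * l)"
    using exact_agg_step[OF \<open>semigroup f\<close> \<open>t \<le> S\<close>] by (simp add: G_def)
  finally show ?case .
qed

theorem mainTheorem11:
  fixes S H :: nat
    and A :: "nat \<Rightarrow> nat \<Rightarrow> 'a set"
    and P :: "nat \<Rightarrow> nat \<Rightarrow> 'a \<Rightarrow> nat \<Rightarrow> real"
    and f :: "real ^ 'm \<Rightarrow> real ^ 'm \<Rightarrow> real ^ 'm"
    and g :: "real \<Rightarrow> real"
    and l :: real
  assumes "\<And>h s a. h \<in> {1..H} \<Longrightarrow> s \<in> {1..S} \<Longrightarrow> a \<in> A h s \<Longrightarrow> prob_vector S (P h s a)"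
    and "SR_operator f"
    and "SR_weight g"
    and "SR_aggregate_lipschitz S f g"
    and "l > 0"
  shows "\<forall>h\<in>{1..H}. \<forall>s\<in>{1..S}. \<forall>a\<in>A h s. \<forall>b :: nat \<Rightarrow> real ^ 'm. \<forall>u :: real ^ 'm. \<forall>t\<in>{1..S+1}.
           exact_agg S f g (P h s a) b t u \<le> rounded_agg S l f g (P h s a) b t u \<and>
           rounded_agg S l f g (P h s a) b t u
             \<le> exact_agg S f g (P h s a) b t u + vec ((real S - real t + 1) * l)"
proof (intro ballI allI conjI)
  fix h s a t and b :: "nat \<Rightarrow> real ^ 'm" and u :: "real ^ 'm"
  assume "t \<in> {1..S+1}"
  then have "t \<le> S + 1" by simp
  have "semigroup f"
    using \<open>SR_operator f\<close> by (rule SR_operator_semigroup)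
  then show "exact_agg S f g (P h s a) b t u \<le> rounded_agg S l f g (P h s a) b t u"
    using SR_operator_mono_left[OF \<open>SR_operator f\<close>] \<open>l > 0\<close> \<open>t \<le> S + 1\<close>
    by (rule exact_agg_le_rounded_agg)
  show "rounded_agg S l f g (P h s a) b t u
      \<le> exact_agg S f g (P h s a) b t u + vec ((real S - real t + 1) * l)"
    using \<open>semigroup f\<close> SR_operator_nonexpansive_left[OF \<open>SR_operator f\<close>] \<open>l > 0\<close> \<open>t \<le> S + 1\<close>
    by (rule rounded_agg_le_exact_agg_add_vec)
qed

end
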